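(* Let $k\ge2$ be an integer and $q=p^r$ with $p$ prime and $r\ge1$. For $n\ge k$ let $$R_{2,3,\dots,k}(n)=\sum_{i=1}^{n}X_iX_{i+1}\cdots X_{i+k-1}\in\mathbb{F}_q[X_1,\dots,X_n],$$ with indices taken modulo $n$ in the residue system $\{1,\dots,n\}$. Then the sequence $\{S_{\mathbb{F}_q}(R_{2,3,\dots,k}(n))\}_{n\ge k}$ satisfies a homogeneous linear recurrence with integer coefficients.
   Context: For $F\in\mathbb{F}_q[X_1,\dots,X_n]$, $S_{\mathbb{F}_q}(F)=\sum_{\mathbf{x}\in\mathbb{F}_q^n}e^{\frac{2\pi i}{p}\mathrm{Tr}_{\mathbb{F}_q/\mathbb{F}_p}(F(\mathbf{x}))}$, with $\mathrm{Tr}_{\mathbb{F}_q/\mathbb{F}_p}$ the field trace. *)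

theory Defs
  imports
    "HOL-Analysis.Analysis"
    "HOL-Library.Poly_Mapping"
    "HOL-Number_Theory.Residues"
begin

(* Multivariate polynomials are finitely supported maps from exponent vectors to
   coefficients; the ring structure is the one of HOL-Library.Poly_Mapping. *)
type_synonym 'a multipoly = "(nat \<Rightarrow>\<^sub>0 nat) \<Rightarrow>\<^sub>0 'a"

definition X :: "nat \<Rightarrow> 'a::comm_semiring_1 multipoly" where
  "X i = Poly_Mapping.single (Poly_Mapping.single i 1) 1"

definition multipoly_eval :: "(nat \<Rightarrow> 'a) \<Rightarrow> 'a::comm_semiring_1 multipoly \<Rightarrow> 'a" where
  "multipoly_eval x F =
     (\<Sum>m\<in>Poly_Mapping.keys F. Poly_Mapping.lookup F m *
        (\<Prod>i\<in>Poly_Mapping.keys m. x i ^ Poly_Mapping.lookup m i))"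

(* The trace of the field with p ^ r elements over its prime field, as an element of the
   big field. *)
definition field_trace :: "nat \<Rightarrow> nat \<Rightarrow> 'a::comm_semiring_1 \<Rightarrow> 'a" where
  "field_trace p r a = (\<Sum>j<r. a ^ (p ^ j))"

(* The representative in {0..<p} of an element of the prime field. Which representative is
   chosen does not matter for the exponential sum below. *)
definition prime_field_rep :: "nat \<Rightarrow> 'a::semiring_1 \<Rightarrow> nat" where
  "prime_field_rep p t = (THE m. m < p \<and> of_nat m = t)"

(* The trace lies in the prime field, so that prime_field_rep is meaningful on it. *)
lemma field_trace_in_prime_field:
  fixes a :: "'a::{field,finite}"
  assumes p: "prime p" and r: "r \<ge> 1" and card: "CARD('a) = p ^ r"
  shows "\<exists>!m. m < p \<and> of_nat m = field_trace p r a"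
proof -
  have "CHAR('a) dvd p ^ r"
    using CHAR_dvd_CARD[where 'a='a] card by simp
  moreover have "prime CHAR('a)"
    by (intro prime_CHAR_semidom finite_imp_CHAR_pos) auto
  ultimately have char: "CHAR('a) = p"
    using p by (metis prime_dvd_power primes_dvd_imp_eq)
  have inj: "inj_on (of_nat :: nat \<Rightarrow> 'a) {..<p}"
    by (auto simp: inj_on_def of_nat_eq_iff_cong_CHAR char cong_def)
  have fermat: "of_nat m ^ p = (of_nat m :: 'a)" for m
  proof -
    have "of_nat m ^ p = (\<Sum>i<m. (1::'a)) ^ CHAR('a)"
      by (simp add: char)
    also have "\<dots> = (\<Sum>i<m. (1::'a) ^ CHAR('a))"
      by (rule freshmans_dream_sum) (use p char in auto)
    finally show ?thesis by simp
  qed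
  have card_pow: "a ^ CARD('a) = a"
  proof (cases "a = 0")
    case False
    let ?U = "UNIV - {0::'a}"
    have "bij_betw (\<lambda>x. a * x) ?U ?U"
      by (rule bij_betwI[of _ _ _ "\<lambda>x. x / a"]) (use False in auto)
    hence "(\<Prod>x\<in>?U. a * x) = (\<Prod>x\<in>?U. x)"
      by (rule prod.reindex_bij_betw)
    hence "a ^ card ?U * \<Prod>?U = \<Prod>?U"
      by (simp add: prod.distrib)
    hence "a ^ card ?U = 1"
      by simp
    moreover have "CARD('a) = Suc (card ?U)"
      by (simp add: card_Diff_singleton Suc_diff_1 finite_UNIV_card_ge_0)
    ultimately show ?thesis by (metis power_Suc mult.right_neutral)
  qed (simp add: card p prime_gt_0_nat)
  have "field_trace p r a ^ p = (\<Sum>j<r. (a ^ (p ^ j)) ^ CHAR('a))"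
    unfolding field_trace_def char[symmetric]
    by (rule freshmans_dream_sum) (use p char in auto)
  also have "\<dots> = (\<Sum>j<r. a ^ (p ^ Suc j))"
    by (simp add: char mult.commute flip: power_mult)
  also have "\<dots> = field_trace p r a"
  proof -
    have "(\<Sum>j<r. a ^ (p ^ Suc j)) + a ^ (p ^ 0) = (\<Sum>j<Suc r. a ^ (p ^ j))"
      by (subst sum.lessThan_Suc_shift) (simp add: add.commute)
    also have "\<dots> = field_trace p r a + a"
      using card_pow by (simp add: field_trace_def card)
    finally show ?thesis by simp
  qed
  finally have fixed: "field_trace p r a ^ p = field_trace p r a" .
  let ?P = "Polynomial.monom 1 p - Polynomial.monom 1 1 :: 'a poly"
  have p1: "p > 1" using p by (rule prime_gt_1_nat)
  have "Polynomial.coeff ?P p = 1" using p1 by simp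
  hence nz: "?P \<noteq> 0" by (metis coeff_0 zero_neq_one)
  have deg: "Polynomial.degree ?P \<le> p"
    by (rule degree_diff_le) (use p1 in \<open>auto simp: degree_monom_eq\<close>)
  have "(of_nat :: nat \<Rightarrow> 'a) ` {..<p} = {x. poly ?P x = 0}"
  proof (rule card_subset_eq)
    show "card ((of_nat :: nat \<Rightarrow> 'a) ` {..<p}) = card {x. poly ?P x = 0}"
    proof (rule antisym)
      show "card ((of_nat :: nat \<Rightarrow> 'a) ` {..<p}) \<le> card {x. poly ?P x = 0}"
        by (rule card_mono) (auto simp: poly_monom fermat)
      have "card {x. poly ?P x = 0} \<le> p"
        using card_poly_roots_bound[OF nz] deg by linarith
      thus "card {x. poly ?P x = 0} \<le> card ((of_nat :: nat \<Rightarrow> 'a) ` {..<p})"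
        using inj by (simp add: card_image)
    qed
  qed (auto simp: poly_monom fermat)
  hence "field_trace p r a \<in> of_nat ` {..<p}"
    using fixed by (simp add: poly_monom)
  thus ?thesis
    using inj unfolding inj_on_def by (metis imageE lessThan_iff)
qed

definition exp_sum :: "nat \<Rightarrow> nat \<Rightarrow> nat \<Rightarrow> 'a::comm_semiring_1 multipoly \<Rightarrow> complex" where
  "exp_sum p r n F =
     (\<Sum>x \<in> {1..n} \<rightarrow>\<^sub>E UNIV.
        exp (2 * of_real pi * \<i> / of_nat p *
             of_nat (prime_field_rep p (field_trace p r (multipoly_eval x F)))))"

(* The index congruent to m modulo n in {1..n}, for m \<ge> 1. *)
definition cyc_index :: "nat \<Rightarrow> nat \<Rightarrow> nat" where
  "cyc_index n m = (m - 1) mod n + 1"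

definition rot_poly :: "nat \<Rightarrow> nat \<Rightarrow> 'a::comm_semiring_1 multipoly" where
  "rot_poly k n = (\<Sum>i=1..n. \<Prod>j<k. X (cyc_index n (i + j)))"

end

theory Submission
  imports Defs "Jordan_Normal_Form.Char_Poly"
begin

text \<open>
  Cut a cyclic word of length \<open>n + k - 1\<close> as \<open>w @ y\<close> with \<open>w\<close> of length
  \<open>k - 1\<close>; its cyclic windows of length \<open>k\<close> are the windows of \<open>w @ y @ w\<close>. With \<open>\<psi>\<close> the
  summand of the exponential sum as a function of the value of the polynomial,
  summing \<open>\<psi> (a + (sum over the windows of w @ y @ b))\<close> over \<open>y\<close> gives finitely many
  sequences, indexed by \<open>(b, w, a)\<close>, and removing the first letter expresses each of them at
  \<open>n + 1\<close> as a sum of others at \<open>n\<close>. Carrying the partial value \<open>a\<close> as part of the state makes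
  the transfer matrix integral (rather than having entries that are roots of unity), so its
  characteristic polynomial is the desired recurrence.
\<close>

section \<open>Integral linear systems of sequences\<close>

text \<open>With E the shift of sequences, this is P(E) u; it makes sequences a module over the
  integer polynomials.\<close>

definition shift_act :: "int poly \<Rightarrow> (nat \<Rightarrow> 'b::comm_ring_1) \<Rightarrow> nat \<Rightarrow> 'b" where
  "shift_act P u n = (\<Sum>j\<le>Polynomial.degree P. of_int (Polynomial.coeff P j) * u (n + j))"

lemma shift_act_bound:
  assumes "Polynomial.degree P \<le> d"
  shows "shift_act P u n = (\<Sum>j\<le>d. of_int (Polynomial.coeff P j) * u (n + j))"
  unfolding shift_act_def
  by (rule sum.mono_neutral_left) (use assms in \<open>auto simp: coeff_eq_0\<close>)

lemma shift_act_0 [simp]: "shift_act 0 u n = 0"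
  by (simp add: shift_act_def)

lemma shift_act_1 [simp]: "shift_act 1 u n = u n"
  by (simp add: shift_act_def)

lemma shift_act_add: "shift_act (P + Q) u n = shift_act P u n + shift_act Q u n"
proof -
  let ?d = "max (Polynomial.degree P) (Polynomial.degree Q)"
  show ?thesis
    using degree_add_le_max[of P Q]
    by (simp add: shift_act_bound[where d = ?d] algebra_simps sum.distrib)
qed

lemma shift_act_sum: "shift_act (\<Sum>i\<in>A. P i) u n = (\<Sum>i\<in>A. shift_act (P i) u n)"
  by (induction A rule: infinite_finite_induct) (auto simp: shift_act_add)

lemma shift_act_smult: "shift_act (Polynomial.smult a P) u n = of_int a * shift_act P u n"
  by (simp add: shift_act_bound[where d = "Polynomial.degree P"] degree_smult_le sum_distrib_left mult.assoc)

lemma shift_act_pCons: "shift_act (pCons a P) u n = of_int a * u n + shift_act P u (Suc n)"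
  by (simp add: shift_act_bound[OF degree_pCons_le] sum.atMost_Suc_shift shift_act_def
      del: sum.atMost_Suc)

text \<open>The module law. Together with additivity it lets matrix identities over
  \<open>int poly\<close> act on vectors of sequences.\<close>

lemma shift_act_mult: "shift_act (P * Q) u n = shift_act P (shift_act Q u) n"
proof (induction P arbitrary: n)
  case (pCons a P)
  show ?case
    by (simp add: shift_act_add shift_act_smult shift_act_pCons pCons.IH)
qed simp

lemma shift_act_sum_right: "shift_act P (\<lambda>n. \<Sum>i\<in>A. u i n) n = (\<Sum>i\<in>A. shift_act P (u i) n)"
  unfolding shift_act_def by (simp add: sum_distrib_left) (rule sum.swap)

lemma shift_act_zero_right: "shift_act P (\<lambda>n. 0) n = 0"
  by (simp add: shift_act_def)

text \<open>With \<open>E\<close> the shift, the system says \<open>(E - A) u = 0\<close>; multiplying by the adjugate matrix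
  gives \<open>det (E - A) u = 0\<close>.\<close>

lemma char_poly_shift_act:
  fixes A :: "int mat" and u :: "nat \<Rightarrow> nat \<Rightarrow> 'b::comm_ring_1"
  assumes A: "A \<in> carrier_mat N N"
    and u: "\<And>i n. i < N \<Longrightarrow> u i (Suc n) = (\<Sum>j<N. of_int (A $$ (i, j)) * u j n)"
    and k: "k < N"
  shows "shift_act (char_poly A) (u k) n = 0"
proof -
  define C where "C = char_poly_matrix A"
  have C: "C \<in> carrier_mat N N" using A by (simp add: C_def)
  note adj = adj_mat(1,3)[OF C]
  \<comment> \<open>Diagonal entries of \<open>C\<close> are linear polynomials and the others
    constants, so this is row \<open>i\<close> of (E - A) u = 0.\<close>
  have row: "(\<Sum>j<N. shift_act (C $$ (i, j)) (u j) n) = 0" if i: "i < N" for i n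
  proof -
    have "shift_act (C $$ (i, j)) (u j) n =
            (if j = i then u i (Suc n) else 0) - of_int (A $$ (i, j)) * u j n" if "j < N" for j
      using A i that
      by (simp add: C_def char_poly_matrix_def shift_act_add shift_act_pCons)
    thus ?thesis using i by (simp add: sum_subtractf u)
  qed
  \<comment> \<open>Row \<open>k\<close> of the adjugate identity adj(C) C = det(C) I, where det(C)
    is \<open>char_poly A\<close>.\<close>
  have entry: "(\<Sum>i<N. adj_mat C $$ (k, i) * C $$ (i, j)) = (if k = j then char_poly A else 0)"
    if j: "j < N" for j
  proof -
    have "(adj_mat C * C) $$ (k, j) = (\<Sum>i<N. adj_mat C $$ (k, i) * C $$ (i, j))"
      using adj(1) C k j by (simp add: scalar_prod_def atLeast0LessThan)
    thus ?thesis using k j unfolding adj(2)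
      by (cases "k = j") (simp_all add: char_poly_def C_def)
  qed
  have "shift_act (char_poly A) (u k) n =
          (\<Sum>j<N. shift_act (if k = j then char_poly A else 0) (u j) n)"
    using k by (subst sum.remove[of _ k]) auto
  also have "\<dots> = (\<Sum>j<N. \<Sum>i<N. shift_act (adj_mat C $$ (k, i)) (shift_act (C $$ (i, j)) (u j)) n)"
    by (intro sum.cong refl) (simp add: entry[symmetric] shift_act_sum shift_act_mult)
  also have "\<dots> = (\<Sum>i<N. shift_act (adj_mat C $$ (k, i))
                        (\<lambda>n. \<Sum>j<N. shift_act (C $$ (i, j)) (u j) n) n)"
    by (subst sum.swap) (simp add: shift_act_sum_right)
  also have "\<dots> = 0"
    by (intro sum.neutral ballI) (simp add: row shift_act_zero_right)
  finally show ?thesis .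
qed

text \<open>After numbering \<open>I\<close>, the characteristic polynomial annihilates every
  sequence; being monic, it can be solved for the top term without division. One \<open>c\<close>
  serves all indices, so sums of the sequences obey the same recurrence.\<close>

lemma integral_system_recurrence:
  fixes u :: "'i \<Rightarrow> nat \<Rightarrow> 'b::comm_ring_1" and m :: "'i \<Rightarrow> 'i \<Rightarrow> int"
  assumes I: "finite I" "I \<noteq> {}"
    and u: "\<And>i n. i \<in> I \<Longrightarrow> u i (Suc n) = (\<Sum>j\<in>I. of_int (m i j) * u j n)"
  obtains d :: nat and c :: "nat \<Rightarrow> int" where "d \<ge> 1"
    and "\<And>i n. i \<in> I \<Longrightarrow> u i (n + d) = (\<Sum>j<d. of_int (c j) * u i (n + j))"
proof -
  define N where "N = card I"
  obtain h where h: "bij_betw h {..<N} I"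
    using ex_bij_betw_nat_finite[OF I(1)] by (auto simp: N_def atLeast0LessThan)
  define A where "A = mat N N (\<lambda>(i, j). m (h i) (h j))"
  have A: "A \<in> carrier_mat N N" by (simp add: A_def)
  have "u (h i) (Suc n) = (\<Sum>j<N. of_int (A $$ (i, j)) * u (h j) n)" if "i < N" for i n
  proof -
    have "h i \<in> I" using h that by (auto dest: bij_betwE)
    hence "u (h i) (Suc n) = (\<Sum>j<N. of_int (m (h i) (h j)) * u (h j) n)"
      by (simp add: u sum.reindex_bij_betw[OF h, symmetric])
    thus ?thesis using that by (simp add: A_def)
  qed
  hence zero: "shift_act (char_poly A) (u (h k)) n = 0" if "k < N" for k n
    using char_poly_shift_act[OF A, of "\<lambda>i. u (h i)"] that by blast
  have deg: "Polynomial.degree (char_poly A) = N" "Polynomial.coeff (char_poly A) N = 1"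
    using degree_monic_char_poly[OF A] by auto
  show ?thesis
  proof (rule that)
    show "N \<ge> 1" using I by (simp add: N_def Suc_leI card_gt_0_iff)
    fix i n assume "i \<in> I"
    then obtain k where k: "k < N" "i = h k"
      using h by (auto simp: bij_betw_def)
    have "(\<Sum>j<N. of_int (Polynomial.coeff (char_poly A) j) * u i (n + j)) + u i (n + N) = 0"
      using zero[OF k(1), of n] unfolding shift_act_def deg k(2)
      by (simp add: lessThan_Suc_atMost[symmetric] deg)
    thus "u i (n + N) = (\<Sum>j<N. of_int (- Polynomial.coeff (char_poly A) j) * u i (n + j))"
      by (simp add: sum_negf eq_neg_iff_add_eq_0 add.commute)
  qed
qed

section \<open>Window sums of words\<close>

definition window_sum :: "nat \<Rightarrow> 'a::comm_semiring_1 list \<Rightarrow> 'a" where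
  "window_sum k l = (\<Sum>i<length l + 1 - k. \<Prod>j<k. l ! (i + j))"

lemma window_sum_Cons:
  assumes "k \<ge> 1" "length l + 1 \<ge> k"
  shows "window_sum k (c # l) = (\<Prod>j<k. (c # l) ! j) + window_sum k l"
proof -
  have "length (c # l) + 1 - k = Suc (length l + 1 - k)" using assms by simp
  thus ?thesis
    by (simp add: window_sum_def sum.lessThan_Suc_shift del: sum.lessThan_Suc)
qed

text \<open>Appending the first \<open>k - 1\<close> letters unrolls the cycle. As
  \<open>length l\<close> is at least \<open>k - 1\<close>, a window wraps around at most
  once.\<close>

lemma window_sum_cyclic:
  assumes "k \<ge> 1" "length l \<ge> k - 1"
  shows "window_sum k (l @ take (k - 1) l) =
           (\<Sum>i<length l. \<Prod>j<k. l ! ((i + j) mod length l))"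
proof -
  have "(l @ take (k - 1) l) ! (i + j) = l ! ((i + j) mod length l)"
    if "i < length l" "j < k" for i j
  proof (cases "i + j < length l")
    case False
    hence "(i + j) mod length l = i + j - length l"
      using that assms by (simp add: le_mod_geq)
    thus ?thesis using False that assms by (simp add: nth_append)
  qed (simp add: nth_append)
  moreover have "length (l @ take (k - 1) l) + 1 - k = length l" using assms by simp
  ultimately show ?thesis by (simp add: window_sum_def)
qed

section \<open>Transfer system for sums over words\<close>

definition word_sum ::
    "nat \<Rightarrow> ('a::comm_semiring_1 \<Rightarrow> complex) \<Rightarrow> 'a list \<times> 'a list \<times> 'a \<Rightarrow> nat \<Rightarrow> complex" where
  "word_sum k \<psi> = (\<lambda>(b, w, a) n. \<Sum>y | length y = n. \<psi> (a + window_sum k (w @ y @ b)))"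

text \<open>Reading \<open>c\<close> completes exactly one window, \<open>w @ [c]\<close>. The
  memory \<open>w\<close> then slides by one letter, while \<open>b\<close> waits to close the
  cycle.\<close>

definition step ::
    "'a::comm_semiring_1 list \<times> 'a list \<times> 'a \<Rightarrow> 'a \<Rightarrow> 'a list \<times> 'a list \<times> 'a" where
  "step = (\<lambda>(b, w, a) c. (b, tl w @ [c], a + prod_list (w @ [c])))"

lemma sum_lists_append:
  fixes g :: "'a list \<Rightarrow> 'b::comm_monoid_add"
  shows "(\<Sum>x | length x = m + n. g x) = (\<Sum>w | length w = m. \<Sum>y | length y = n. g (w @ y))"
proof -
  have "bij_betw (\<lambda>(w, y). w @ y) ({w. length w = m} \<times> {y. length y = n})
          {x :: 'a list. length x = m + n}"
    by (rule bij_betwI[of _ _ _ "\<lambda>x. (take m x, drop m x)"]) auto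
  from sum.reindex_bij_betw[OF this, of g] show ?thesis
    by (simp add: sum.cartesian_product case_prod_unfold)
qed

lemma sum_lists_Suc:
  fixes g :: "'a list \<Rightarrow> 'b::comm_monoid_add"
  shows "(\<Sum>x | length x = Suc n. g x) = (\<Sum>c\<in>UNIV. \<Sum>y | length y = n. g (c # y))"
proof -
  have "bij_betw (\<lambda>(c, y). c # y) (UNIV \<times> {y. length y = n}) {x :: 'a list. length x = Suc n}"
    by (rule bij_betwI[of _ _ _ "\<lambda>x. (hd x, tl x)"]) (auto simp: length_Suc_conv)
  from sum.reindex_bij_betw[OF this, of g] show ?thesis
    by (simp add: sum.cartesian_product case_prod_unfold)
qed

text \<open>The first letter of \<open>y\<close> is read and its window split off. Since
  \<open>k\<close> is at least 2, \<open>w\<close> is nonempty, so \<open>tl w @ [c]\<close> again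
  has length \<open>k - 1\<close>.\<close>

lemma word_sum_Suc:
  assumes "k \<ge> 2" "length w = k - 1"
  shows "word_sum k \<psi> (b, w, a) (Suc n) = (\<Sum>c\<in>UNIV. word_sum k \<psi> (step (b, w, a) c) n)"
proof -
  obtain h t where w: "w = h # t" using assms by (cases w) auto
  have "window_sum k (w @ (c # y) @ b) = prod_list (w @ [c]) + window_sum k ((tl w @ [c]) @ y @ b)"
    for c y
  proof -
    have "window_sum k (w @ (c # y) @ b) =
            (\<Prod>j<k. (w @ (c # y) @ b) ! j) + window_sum k ((tl w @ [c]) @ y @ b)"
      using assms unfolding w by (simp add: window_sum_Cons)
    also have "(\<Prod>j<k. (w @ (c # y) @ b) ! j) = (\<Prod>j<k. (w @ [c]) ! j)"
      by (rule prod.cong) (use assms in \<open>auto simp: nth_append less_Suc_eq_le nth_Cons'\<close>)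
    also have "\<dots> = prod_list (w @ [c])"
      using assms prod.list_conv_set_nth[of "w @ [c]"] by (simp add: atLeast0LessThan)
    finally show ?thesis .
  qed
  thus ?thesis
    by (simp add: word_sum_def step_def sum_lists_Suc add.assoc)
qed

lemma word_sum_recurrence:
  fixes \<psi> :: "'a::{comm_semiring_1,finite} \<Rightarrow> complex"
  assumes "k \<ge> 2"
  obtains d :: nat and c :: "nat \<Rightarrow> int" where "d \<ge> 1"
    and "\<And>b w a n. length b = k - 1 \<Longrightarrow> length w = k - 1 \<Longrightarrow>
           word_sum k \<psi> (b, w, a) (n + d) = (\<Sum>j<d. of_int (c j) * word_sum k \<psi> (b, w, a) (n + j))"
proof -
  define L where "L = {w :: 'a list. length w = k - 1}"
  define I where "I = L \<times> L \<times> (UNIV :: 'a set)"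
  have "finite L" using finite_lists_length_eq[of "UNIV :: 'a set" "k - 1"] by (simp add: L_def)
  hence fin: "finite I" by (simp add: I_def)
  have "replicate (k - 1) 0 \<in> L" by (simp add: L_def)
  hence ne: "I \<noteq> {}" by (auto simp: I_def)
  have "word_sum k \<psi> s (Suc n) =
          (\<Sum>t\<in>I. of_int (int (card {c. step s c = t})) * word_sum k \<psi> t n)" if "s \<in> I" for s n
  proof -
    obtain b w a where s: "s = (b, w, a)" and len: "length b = k - 1" "length w = k - 1"
      using \<open>s \<in> I\<close> by (cases s) (auto simp: I_def L_def)
    have "step s ` UNIV \<subseteq> I"
      using len assms by (auto simp: s step_def I_def L_def)
    \<comment> \<open>Grouping letters by the state they lead to turns the coefficients into
      cardinalities, hence integers.\<close>
    hence "(\<Sum>c\<in>UNIV. word_sum k \<psi> (step s c) n) =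
            (\<Sum>t\<in>I. \<Sum>c | c \<in> UNIV \<and> step s c = t. word_sum k \<psi> (step s c) n)"
      using fin by (intro sum.group[symmetric]) auto
    also have "\<dots> = (\<Sum>t\<in>I. of_int (int (card {c. step s c = t})) * word_sum k \<psi> t n)"
      by (intro sum.cong refl) simp
    finally show ?thesis using word_sum_Suc[OF assms len(2)] by (simp add: s)
  qed
  from integral_system_recurrence[where u = "word_sum k \<psi>"
      and m = "\<lambda>s t. int (card {c. step s c = t})", OF fin ne this] obtain d c where
    "d \<ge> 1" "\<And>i n. i \<in> I \<Longrightarrow>
      word_sum k \<psi> i (n + d) = (\<Sum>j<d. of_int (c j) * word_sum k \<psi> i (n + j))"
    by metis
  thus ?thesis by (intro that[of d c]) (auto simp: I_def L_def)
qed

section \<open>Evaluation of the rotation polynomials\<close>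

lemma multipoly_eval_superset:
  assumes "finite A" "Poly_Mapping.keys F \<subseteq> A"
  shows "multipoly_eval x F =
           (\<Sum>m\<in>A. Poly_Mapping.lookup F m *
              (\<Prod>i\<in>Poly_Mapping.keys m. x i ^ Poly_Mapping.lookup m i))"
  unfolding multipoly_eval_def
  by (rule sum.mono_neutral_left) (use assms in \<open>auto simp: in_keys_iff\<close>)

lemma multipoly_eval_add: "multipoly_eval x (F + G) = multipoly_eval x F + multipoly_eval x G"
proof -
  let ?A = "Poly_Mapping.keys F \<union> Poly_Mapping.keys G"
  have "Poly_Mapping.keys (F + G) \<subseteq> ?A" by (rule Poly_Mapping.keys_add)
  thus ?thesis
    by (simp add: multipoly_eval_superset[of ?A] lookup_add algebra_simps sum.distrib)
qed

lemma multipoly_eval_sum: "multipoly_eval x (\<Sum>i\<in>A. F i) = (\<Sum>i\<in>A. multipoly_eval x (F i))"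
  by (induction A rule: infinite_finite_induct)
    (auto simp: multipoly_eval_add multipoly_eval_def[of x 0])

lemma prod_keys_add:
  fixes x :: "nat \<Rightarrow> 'a::comm_semiring_1"
  shows "(\<Prod>i\<in>Poly_Mapping.keys (m + m'). x i ^ Poly_Mapping.lookup (m + m') i) =
     (\<Prod>i\<in>Poly_Mapping.keys m. x i ^ Poly_Mapping.lookup m i) *
     (\<Prod>i\<in>Poly_Mapping.keys m'. x i ^ Poly_Mapping.lookup m' i)"
proof -
  let ?A = "Poly_Mapping.keys m \<union> Poly_Mapping.keys m'"
  have superset: "(\<Prod>i\<in>Poly_Mapping.keys M. x i ^ Poly_Mapping.lookup M i) =
          (\<Prod>i\<in>?A. x i ^ Poly_Mapping.lookup M i)" if "Poly_Mapping.keys M \<subseteq> ?A" for M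
    by (rule prod.mono_neutral_left) (use that in \<open>auto simp: in_keys_iff\<close>)
  show ?thesis
    unfolding superset[OF Poly_Mapping.keys_add] superset[OF Un_upper1] superset[OF Un_upper2]
    by (simp only: lookup_add power_add prod.distrib)
qed

lemma prod_X:
  "(\<Prod>j\<in>A. X (g j)) = Poly_Mapping.single (\<Sum>j\<in>A. Poly_Mapping.single (g j) 1) 1"
  by (induction A rule: infinite_finite_induct) (auto simp: X_def mult_single)

text \<open>A product of variables is a single monomial with coefficient 1, so multiplicativity on
  monomials (\<open>prod_keys_add\<close>) suffices. Repeated variables are allowed.\<close>

lemma multipoly_eval_prod_X: "multipoly_eval x (\<Prod>j\<in>A. X (g j)) = (\<Prod>j\<in>A. x (g j))"
proof -
  let ?e = "\<lambda>m. \<Prod>i\<in>Poly_Mapping.keys m. x i ^ Poly_Mapping.lookup m i"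
  have "?e (\<Sum>j\<in>A. Poly_Mapping.single (g j) 1) = (\<Prod>j\<in>A. x (g j))"
    by (induction A rule: infinite_finite_induct) (simp_all add: prod_keys_add)
  thus ?thesis
    by (simp add: prod_X multipoly_eval_def)
qed

lemma multipoly_eval_rot_poly:
  "multipoly_eval x (rot_poly k n) = (\<Sum>i<n. \<Prod>j<k. x ((i + j) mod n + 1))"
proof -
  have "multipoly_eval x (rot_poly k n) = (\<Sum>i=1..n. \<Prod>j<k. x ((i + j - 1) mod n + 1))"
    by (simp add: rot_poly_def multipoly_eval_sum multipoly_eval_prod_X cyc_index_def)
  also have "\<dots> = (\<Sum>i<n. \<Prod>j<k. x ((i + j) mod n + 1))"
    by (rule sum.reindex_bij_witness[of _ Suc "\<lambda>i. i - 1"]) auto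
  finally show ?thesis .
qed

section \<open>The exponential sum as a sum over words\<close>

lemma bij_betw_lists_PiE:
  "bij_betw (\<lambda>l. \<lambda>i\<in>{1..n}. l ! (i - 1)) {l :: 'a list. length l = n} ({1..n} \<rightarrow>\<^sub>E UNIV)"
  \<comment> \<open>The inverse reads off the values at the indices 1 to \<open>n\<close>, since
    list positions start at 0.\<close>
  by (rule bij_betwI[of _ _ _ "\<lambda>x. map (\<lambda>i. x (Suc i)) [0..<n]"])
    (auto simp: fun_eq_iff PiE_def extensional_def intro!: nth_equalityI)

text \<open>Splitting an assignment as \<open>w @ y\<close> makes the appended prefix equal to
  \<open>w\<close>, so only the states with \<open>b = w\<close> and \<open>a = 0\<close>
  contribute.\<close>

lemma exp_sum_rot_poly:
  fixes p r :: nat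
  defines "\<psi> \<equiv> \<lambda>t :: 'a::comm_semiring_1.
    exp (2 * of_real pi * \<i> / of_nat p * of_nat (prime_field_rep p (field_trace p r t)))"
  assumes k: "k \<ge> 1"
  shows "exp_sum p r (k - 1 + n) (rot_poly k (k - 1 + n) :: 'a multipoly) =
           (\<Sum>w | length w = k - 1. word_sum k \<psi> (w, w, 0) n)"
proof -
  let ?N = "k - 1 + n"
  have "exp_sum p r ?N (rot_poly k ?N :: 'a multipoly) =
          (\<Sum>x \<in> {1..?N} \<rightarrow>\<^sub>E UNIV. \<psi> (\<Sum>i<?N. \<Prod>j<k. x ((i + j) mod ?N + 1)))"
    unfolding exp_sum_def multipoly_eval_rot_poly \<psi>_def ..
  also have "\<dots> = (\<Sum>l | length l = ?N. \<psi> (\<Sum>i<?N. \<Prod>j<k. l ! ((i + j) mod ?N)))"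
  proof (subst sum.reindex_bij_betw[OF bij_betw_lists_PiE, symmetric], intro sum.cong refl)
    fix l :: "'a list"
    \<comment> \<open>The bound on \<open>i\<close> forces \<open>?N\<close> to be positive; the
      index then lies where the restricted function agrees with the list.\<close>
    have "(i + j) mod ?N + 1 \<in> {1..?N}" if "i < ?N" for i j
    proof -
      have "(i + j) mod ?N < ?N" using that by (intro mod_less_divisor) linarith
      thus ?thesis by simp
    qed
    thus "\<psi> (\<Sum>i<?N. \<Prod>j<k. (\<lambda>i\<in>{1..?N}. l ! (i - 1)) ((i + j) mod ?N + 1)) =
          \<psi> (\<Sum>i<?N. \<Prod>j<k. l ! ((i + j) mod ?N))"
      by (intro arg_cong[of _ _ \<psi>] sum.cong prod.cong refl) (simp del: One_nat_def)
  qed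
  also have "\<dots> = (\<Sum>l | length l = ?N. \<psi> (window_sum k (l @ take (k - 1) l)))"
    using k by (intro sum.cong refl) (simp add: window_sum_cyclic[unfolded One_nat_def])
  also have "\<dots> = (\<Sum>w | length w = k - 1. word_sum k \<psi> (w, w, 0) n)"
    unfolding sum_lists_append word_sum_def by (intro sum.cong refl) simp
  finally show ?thesis .
qed

theorem theorem3p6:
  fixes k p r :: nat
  assumes "k \<ge> 2"
    and "prime p" and "r \<ge> 1"
    and "CARD('a::{field,finite}) = p ^ r"
  shows "\<exists>(d::nat) (c :: nat \<Rightarrow> int). d \<ge> 1 \<and>
           (\<forall>n\<ge>k. exp_sum p r (n + d) (rot_poly k (n + d) :: 'a multipoly) =
              (\<Sum>j<d. of_int (c j) * exp_sum p r (n + j) (rot_poly k (n + j) :: 'a multipoly)))"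
proof -
  define \<psi> where "\<psi> = (\<lambda>t :: 'a.
    exp (2 * of_real pi * \<i> / of_nat p * of_nat (prime_field_rep p (field_trace p r t))))"
  define S where "S n = exp_sum p r n (rot_poly k n :: 'a multipoly)" for n
  obtain d c where d: "d \<ge> 1" and rec: "\<And>b w a n. length b = k - 1 \<Longrightarrow> length w = k - 1 \<Longrightarrow>
      word_sum k \<psi> (b, w, a) (n + d) = (\<Sum>j<d. of_int (c j) * word_sum k \<psi> (b, w, a) (n + j))"
    using word_sum_recurrence[OF assms(1), of \<psi>] by blast
  have S: "S (k - 1 + n) = (\<Sum>w | length w = k - 1. word_sum k \<psi> (w, w, 0) n)" for n
    using exp_sum_rot_poly[of k p r n] assms(1) by (simp add: S_def \<psi>_def)
  have "S (n + d) = (\<Sum>j<d. of_int (c j) * S (n + j))" if "n \<ge> k" for n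
  proof -
    \<comment> \<open>The first \<open>k - 1\<close> variables form \<open>w\<close>;
      \<open>m\<close> is the length of the remaining word.\<close>
    define m where "m = n - (k - 1)"
    have n: "n = k - 1 + m" using that by (simp add: m_def)
    have "S (n + d) = (\<Sum>w | length w = k - 1. word_sum k \<psi> (w, w, 0) (m + d))"
      by (simp only: n S add.assoc)
    \<comment> \<open>\<open>d\<close> and \<open>c\<close> do not depend on \<open>w\<close>, so
      the recurrence is applied in each summand.\<close>
    also have "\<dots> = (\<Sum>w | length w = k - 1. \<Sum>j<d. of_int (c j) * word_sum k \<psi> (w, w, 0) (m + j))"
      by (intro sum.cong refl) (simp add: rec)
    also have "\<dots> = (\<Sum>j<d. of_int (c j) * S (n + j))"
      by (subst sum.swap) (simp only: n S add.assoc sum_distrib_left)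
    finally show ?thesis .
  qed
  with d show ?thesis unfolding S_def by blast
qed

end
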